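(* Let $1\le n\le N/2$ and let $A$ be a positive definite Hermitian $N\times N$ complex matrix, written in blocks as $$A=\begin{pmatrix} A_{11} & A_{12} \\ A_{12}^{\star} & A_{22} \end{pmatrix},\qquad A_{11}\in\mathbb{C}^{n\times n},\ A_{12}\in\mathbb{C}^{n\times (N-n)},\ A_{22}\in\mathbb{C}^{(N-n)\times(N-n)}.$$ Set $R:=A_{11}^{-1/2}A_{12}A_{22}^{-1/2}$ and $F:=R^{\star}\in\mathbb{C}^{(N-n)\times n}$. Then $F^{\star}F<I_n$, the matrix $$\begin{pmatrix} (I_{N-n}-FF^{\star})^{-1/2} & F(I_n-F^{\star}F)^{-1/2} \\ F^{\star}(I_{N-n}-FF^{\star})^{-1/2} & (I_n-F^{\star}F)^{-1/2} \end{pmatrix}$$ belongs to $\mathbf{U}(N-n,n)$, its lower-right block $Z_F$ satisfies $Z_FZ_F^{\star}=(I_n-RR^{\star})^{-1}$, and the matrix $\pi_n(A)\pi_n(A^{-1})$ is similar to $Z_FZ_F^{\star}$.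
   Context: $\pi_n(A)$ denotes the upper-left $n\times n$ corner of an $N\times N$ matrix $A$. The indefinite unitary group is $$\mathbf{U}(N-n,n)=\left\{M\in GL(N,\mathbb{C}):\ M^{\star}\begin{pmatrix} I_{N-n} & 0 \\ 0 & -I_n \end{pmatrix}M=\begin{pmatrix} I_{N-n} & 0 \\ 0 & -I_n \end{pmatrix}\right\}.$$ For Hermitian matrices, $<$ refers to the Löwner order (difference positive definite). *)

theory Defs
  imports
    "Jordan_Normal_Form.Schur_Decomposition"
    "Jordan_Normal_Form.Gauss_Jordan_Elimination"
begin

definition hermitian_mat :: "complex mat \<Rightarrow> bool" where
  "hermitian_mat A \<longleftrightarrow> square_mat A \<and> mat_adjoint A = A"

text \<open>For Hermitian \<open>A\<close> the number \<open>(A v) \<bullet>c v\<close>, that is \<open>v\<^sup>* A v\<close>, is real, so taking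
  the real part only selects the type.\<close>

definition pos_semidef_mat :: "complex mat \<Rightarrow> bool" where
  "pos_semidef_mat A \<longleftrightarrow> hermitian_mat A \<and>
    (\<forall>v \<in> carrier_vec (dim_row A). 0 \<le> Re ((A *\<^sub>v v) \<bullet>c v))"

definition pos_def_mat :: "complex mat \<Rightarrow> bool" where
  "pos_def_mat A \<longleftrightarrow> hermitian_mat A \<and>
    (\<forall>v \<in> carrier_vec (dim_row A). v \<noteq> 0\<^sub>v (dim_row A) \<longrightarrow> 0 < Re ((A *\<^sub>v v) \<bullet>c v))"

text \<open>The library order \<open><\<close> on matrices is entrywise, hence a separate constant for the
  Loewner order. Matrix subtraction takes its dimensions from the second argument, so equality
  of the dimensions has to be required.\<close>

definition loewner_less :: "complex mat \<Rightarrow> complex mat \<Rightarrow> bool" where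
  "loewner_less A B \<longleftrightarrow> hermitian_mat A \<and> hermitian_mat B \<and> dim_row A = dim_row B \<and>
    pos_def_mat (B - A)"

text \<open>\<open>A\<^sup>-\<^sup>1\<close>, meaningful only if \<open>A\<close> is invertible.\<close>

definition mat_inv :: "complex mat \<Rightarrow> complex mat" where
  "mat_inv A = the (mat_inverse A)"

text \<open>\<open>A\<close> to the power \<open>1/2\<close> is the unique positive semidefinite square root; it is meaningful
  only for positive semidefinite \<open>A\<close>, and \<open>A\<close> to the power \<open>-1/2\<close> only for positive
  definite \<open>A\<close>.\<close>

definition mat_sqrt :: "complex mat \<Rightarrow> complex mat" where
  "mat_sqrt A = (THE B. pos_semidef_mat B \<and> B * B = A)"

definition mat_inv_sqrt :: "complex mat \<Rightarrow> complex mat" where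
  "mat_inv_sqrt A = mat_inv (mat_sqrt A)"

definition corner :: "nat \<Rightarrow> complex mat \<Rightarrow> complex mat" where
  "corner n A = mat n n (\<lambda>(i, j). A $$ (i, j))"

definition lower_right_block :: "nat \<Rightarrow> complex mat \<Rightarrow> complex mat" where
  "lower_right_block n M =
    mat n n (\<lambda>(i, j). M $$ (dim_row M - n + i, dim_col M - n + j))"

definition signature_mat :: "nat \<Rightarrow> nat \<Rightarrow> complex mat" where
  "signature_mat p q = four_block_mat (1\<^sub>m p) (0\<^sub>m p q) (0\<^sub>m q p) (- 1\<^sub>m q)"

definition indef_unitary_group :: "nat \<Rightarrow> nat \<Rightarrow> complex mat set" where
  "indef_unitary_group p q =
    {M \<in> carrier_mat (p + q) (p + q). invertible_mat M \<and>
      mat_adjoint M * signature_mat p q * M = signature_mat p q}"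

end

theory Submission
  imports Defs "Jordan_Normal_Form.Spectral_Radius"
begin

text \<open>
  Let \<open>T = diag (A\<^sub>1\<^sub>1\<^sup>-\<^sup>1\<^sup>/\<^sup>2, A\<^sub>2\<^sub>2\<^sup>-\<^sup>1\<^sup>/\<^sup>2)\<close>. The congruence \<open>T A T\<close> has unit diagonal blocks and off-diagonal
  blocks \<open>R\<close>, \<open>R\<^sup>*\<close>. Testing its positive definiteness on the vectors \<open>(v, - R\<^sup>* v)\<close> and \<open>(- R w, w)\<close>
  shows that \<open>I - R R\<^sup>*\<close> and \<open>I - R\<^sup>* R\<close> are positive definite. Their inverse square roots then exist, and
  \<open>M\<^sup>* J M = J\<close> is a direct block computation. Block elimination in \<open>A Y = I\<close> gives
  \<open>Y\<^sub>1\<^sub>1 = A\<^sub>1\<^sub>1\<^sup>-\<^sup>1\<^sup>/\<^sup>2 (I - R R\<^sup>*)\<^sup>-\<^sup>1 A\<^sub>1\<^sub>1\<^sup>-\<^sup>1\<^sup>/\<^sup>2\<close>, so \<open>A\<^sub>1\<^sub>1 Y\<^sub>1\<^sub>1\<close> is conjugate to \<open>(I - R R\<^sup>*)\<^sup>-\<^sup>1\<close> by \<open>A\<^sub>1\<^sub>1\<^sup>1\<^sup>/\<^sup>2\<close>.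
\<close>

section \<open>Adjoint and product rules for complex matrices\<close>

lemma dim_mat_adjoint [simp]:
  "dim_row (mat_adjoint A) = dim_col A" "dim_col (mat_adjoint A) = dim_row A"
  by (auto simp: mat_adjoint_def)

lemma index_mat_adjoint [simp]:
  "i < dim_col A \<Longrightarrow> j < dim_row A \<Longrightarrow> mat_adjoint A $$ (i, j) = conjugate (A $$ (j, i))"
  by (simp add: mat_adjoint_def mat_of_rows_index)

lemma mat_adjoint_carrier [simp]:
  "A \<in> carrier_mat n m \<Longrightarrow> mat_adjoint A \<in> carrier_mat m n"
  by auto

lemma mat_adjoint_mat_adjoint [simp]: "mat_adjoint (mat_adjoint A) = A"
  by (rule eq_matI) auto

lemma mat_adjoint_one [simp]: "mat_adjoint (1\<^sub>m n :: complex mat) = 1\<^sub>m n"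
  by (rule eq_matI) auto

lemma mat_adjoint_zero [simp]: "mat_adjoint (0\<^sub>m n m :: complex mat) = 0\<^sub>m m n"
  by (rule eq_matI) auto

lemma mat_adjoint_minus:
  fixes A B :: "complex mat"
  assumes "dim_row A = dim_row B" "dim_col A = dim_col B"
  shows "mat_adjoint (A - B) = mat_adjoint A - mat_adjoint B"
  by (rule eq_matI) (use assms in auto)

lemma mat_adjoint_mult:
  fixes A B :: "complex mat"
  assumes "dim_col A = dim_row B"
  shows "mat_adjoint (A * B) = mat_adjoint B * mat_adjoint A"
  by (rule eq_matI) (use assms in \<open>auto simp: scalar_prod_def mult.commute\<close>)

lemma mat_adjoint_four_block:
  fixes A B C D :: "complex mat"
  assumes "A \<in> carrier_mat n1 m1" "B \<in> carrier_mat n1 m2"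
    "C \<in> carrier_mat n2 m1" "D \<in> carrier_mat n2 m2"
  shows "mat_adjoint (four_block_mat A B C D)
    = four_block_mat (mat_adjoint A) (mat_adjoint C) (mat_adjoint B) (mat_adjoint D)"
  by (rule eq_matI) (use assms in auto)

lemma mult_mat_assoc:
  fixes A B C :: "complex mat"
  assumes "dim_col A = dim_row B" "dim_col B = dim_row C"
  shows "A * B * C = A * (B * C)"
  using assms by (metis assoc_mult_mat carrier_matI)

lemma mult_mat_vec_assoc:
  fixes A B :: "complex mat"
  assumes "dim_col A = dim_row B" "dim_col B = dim_vec v"
  shows "A * B *\<^sub>v v = A *\<^sub>v (B *\<^sub>v v)"
  using assms by (metis assoc_mult_mat_vec carrier_matI carrier_vec_dim_vec)

text \<open>Products are normalised to right-nested form by \<open>mult_mat_assoc\<close>; an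
  inverse pair then sits at the head of a longer product, and this rule removes it.\<close>

lemma mult_cancel_inverse:
  fixes A B C :: "complex mat"
  assumes "A * B = 1\<^sub>m n" "dim_col A = dim_row B" "dim_col B = dim_row C" "dim_row C = n"
  shows "A * (B * C) = C"
  using assms by (metis mult_mat_assoc left_mult_one_mat')

lemma mult_mat_zero_vec [simp]:
  "dim_col A = n \<Longrightarrow> A *\<^sub>v 0\<^sub>v n = (0\<^sub>v (dim_row A) :: complex vec)"
  by (rule eq_vecI) (auto simp: scalar_prod_def)

lemma mult_mat_uminus_vec [simp]:
  "dim_col A = dim_vec v \<Longrightarrow> A *\<^sub>v (- v) = - (A *\<^sub>v v :: complex vec)"
  by (rule eq_vecI) auto

lemma mult_mat_vec_cscalar_prod:
  fixes A :: "complex mat"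
  assumes A: "A \<in> carrier_mat n m" and x: "x \<in> carrier_vec m" and y: "y \<in> carrier_vec n"
  shows "(A *\<^sub>v x) \<bullet>c y = x \<bullet>c (mat_adjoint A *\<^sub>v y)"
proof -
  have "(A *\<^sub>v x) \<bullet>c y = (\<Sum>i<n. \<Sum>j<m. A $$ (i, j) * x $ j * cnj (y $ i))"
    using assms by (auto simp: scalar_prod_def sum_distrib_right lessThan_atLeast0)
  also have "\<dots> = (\<Sum>j<m. \<Sum>i<n. A $$ (i, j) * x $ j * cnj (y $ i))"
    by (rule sum.swap)
  also have "\<dots> = x \<bullet>c (mat_adjoint A *\<^sub>v y)"
    using assms by (auto simp: scalar_prod_def sum_distrib_left lessThan_atLeast0 ac_simps intro!: sum.cong)
  finally show ?thesis .
qed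

lemma Re_cscalar_prod_self:
  fixes v :: "complex vec"
  assumes "v \<in> carrier_vec n"
  shows "0 \<le> Re (v \<bullet>c v)" "v \<noteq> 0\<^sub>v n \<Longrightarrow> 0 < Re (v \<bullet>c v)" "Im (v \<bullet>c v) = 0"
  using conjugate_square_ge_0_vec[of v] conjugate_square_greater_0_vec[OF assms]
  by (auto simp: less_eq_complex_def less_complex_def)

section \<open>Unitary diagonalisation of Hermitian matrices\<close>

text \<open>Complete \<open>v\<close> to a basis, orthogonalise it by Gram-Schmidt, which keeps the
  head \<open>v\<close>, and normalise. The witness for \<open>c\<close> is the reciprocal norm of
  \<open>v\<close>.\<close>

lemma eigenvector_extends_to_unitary:
  assumes v: "v \<in> carrier_vec n" and v0: "v \<noteq> 0\<^sub>v n" and n: "n \<noteq> 0"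
  shows "\<exists>U c. U \<in> carrier_mat n n \<and> mat_adjoint U * U = (1\<^sub>m n :: complex mat) \<and> col U 0 = c \<cdot>\<^sub>v v"
proof -
  interpret cof_vec_space n "TYPE(complex)" .
  define b where "b = basis_completion v"
  define ws where "ws = gram_schmidt n b"
  from basis_completion[OF v v0, folded b_def]
  have dist_b: "distinct b" and indep: "\<not> lin_dep (set b)" and b: "set b \<subseteq> carrier_vec n"
    and hdb: "hd b = v" and len_b: "length b = n" by auto
  from hdb len_b n obtain vs where bv: "b = v # vs" by (cases b) auto
  from gram_schmidt_result[OF b dist_b indep refl, folded ws_def]
  have ws: "set ws \<subseteq> carrier_vec n" "corthogonal ws" "length ws = n"
    by (auto simp: len_b)
  from gram_schmidt_hd[OF v, of vs, folded bv] have hdws: "hd ws = v" unfolding ws_def .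
  have wsi: "ws ! i \<in> carrier_vec n" if "i < n" for i using ws that by auto
  \<comment> \<open>Reciprocal norm of \<open>ws ! i\<close>; the output of
    \<open>gram_schmidt\<close> is only orthogonal.\<close>
  define f where "f i = complex_of_real (1 / sqrt (Re (ws ! i \<bullet>c ws ! i)))" for i
  define U where "U = mat_of_cols n (map (\<lambda>i. f i \<cdot>\<^sub>v ws ! i) [0..<n])"
  have U: "U \<in> carrier_mat n n" unfolding U_def by auto
  have colU: "col U i = f i \<cdot>\<^sub>v ws ! i" if "i < n" for i
    unfolding U_def using that wsi by (subst col_mat_of_cols) auto
  have "mat_adjoint U * U = 1\<^sub>m n"
  proof (rule eq_matI)
    fix i j assume "i < dim_row (1\<^sub>m n :: complex mat)" "j < dim_col (1\<^sub>m n :: complex mat)"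
    then have ij: "i < n" "j < n" by auto
    have "(mat_adjoint U * U) $$ (i, j) = conjugate (col U i) \<bullet> col U j"
      using ij U by (auto simp: scalar_prod_def)
    also have "\<dots> = col U j \<bullet>c col U i"
      by (rule comm_scalar_prod[of _ n]) (use U in auto)
    also have "\<dots> = f i * f j * (ws ! j \<bullet>c ws ! i)"
      using ij wsi[of i] wsi[of j] by (simp add: colU f_def conjugate_smult_vec)
    also have "\<dots> = 1\<^sub>m n $$ (i, j)"
    proof (cases "i = j")
      case True
      let ?q = "ws ! i \<bullet>c ws ! i"
      \<comment> \<open>\<open>corthogonal\<close> says that products vanish exactly for distinct
        indices, so it also gives nonzero diagonal products.\<close>
      have "?q \<noteq> 0" using ws(2,3) ij(1) by (auto simp: corthogonal_def)
      then have "ws ! i \<noteq> 0\<^sub>v n" using wsi[OF ij(1)] by auto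
      from Re_cscalar_prod_self[OF wsi[OF ij(1)]] this
      have "0 < Re ?q" "?q = of_real (Re ?q)" by (auto simp: complex_eq_iff)
      then have "f i * f i * ?q = of_real (1 / sqrt (Re ?q) * (1 / sqrt (Re ?q)) * Re ?q)"
        unfolding f_def by (metis of_real_mult)
      then show ?thesis using True ij \<open>0 < Re ?q\<close> by (simp add: real_sqrt_mult_self)
    next
      case False
      then show ?thesis using ws(2,3) ij by (auto simp: corthogonal_def)
    qed
    finally show "(mat_adjoint U * U) $$ (i, j) = 1\<^sub>m n $$ (i, j)" .
  qed (use U in auto)
  moreover have "col U 0 = f 0 \<cdot>\<^sub>v v"
    using colU[of 0] n hdws ws(3) by (cases ws) auto
  ultimately show ?thesis using U by blast
qed

text \<open>Real entries make the matrix Hermitian and let square roots be taken in the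
  reals.\<close>

definition real_diag :: "nat \<Rightarrow> (nat \<Rightarrow> real) \<Rightarrow> complex mat" where
  "real_diag n d = mat n n (\<lambda>(i, j). if i = j then of_real (d i) else 0)"

lemma real_diag_carrier [simp]: "real_diag n d \<in> carrier_mat n n"
  and dim_real_diag [simp]: "dim_row (real_diag n d) = n" "dim_col (real_diag n d) = n"
  by (auto simp: real_diag_def)

lemma mat_adjoint_real_diag [simp]: "mat_adjoint (real_diag n d) = real_diag n d"
  by (rule eq_matI) (auto simp: real_diag_def)

lemma real_diag_mult: "real_diag n d * real_diag n e = real_diag n (\<lambda>i. d i * e i)"
  by (rule eq_matI)
    (auto simp: real_diag_def scalar_prod_def if_distrib[of "\<lambda>x. x * _"] if_distrib[of "\<lambda>x. _ * x"] cong: if_cong)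

text \<open>Spectral theorem by deflation: split off one eigenvector, which exists over the complex
  numbers, and apply induction to the remaining Hermitian block.\<close>

theorem hermitian_unitarily_diagonalizable:
  fixes A :: "complex mat"
  assumes "A \<in> carrier_mat n n" "mat_adjoint A = A"
  shows "\<exists>U d. U \<in> carrier_mat n n \<and> mat_adjoint U * U = 1\<^sub>m n \<and> A = U * real_diag n d * mat_adjoint U"
  using assms
proof (induct n arbitrary: A)
  case 0
  then show ?case by (intro exI[of _ "1\<^sub>m 0"] exI) (auto intro!: eq_matI)
next
  case (Suc m)
  note A = Suc(2) and hA = Suc(3)
  from spectrum_non_empty[OF A] obtain e where "eigenvalue A e" by (auto simp: spectrum_def)
  then obtain v where v: "v \<in> carrier_vec (Suc m)" "v \<noteq> 0\<^sub>v (Suc m)" "A *\<^sub>v v = e \<cdot>\<^sub>v v"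
    using A by (auto simp: eigenvalue_def eigenvector_def)
  from eigenvector_extends_to_unitary[OF v(1,2)] obtain U c where U: "U \<in> carrier_mat (Suc m) (Suc m)"
    and UU: "mat_adjoint U * U = 1\<^sub>m (Suc m)" and col0: "col U 0 = c \<cdot>\<^sub>v v" by auto
  have UU': "U * mat_adjoint U = 1\<^sub>m (Suc m)"
    by (rule mat_mult_left_right_inverse[OF _ U UU]) (use U in auto)
  \<comment> \<open>\<open>A\<close> in an orthonormal basis whose first vector is a multiple of the
    eigenvector.\<close>
  define B where "B = mat_adjoint U * A * U"
  have B: "B \<in> carrier_mat (Suc m) (Suc m)" unfolding B_def using U A by auto
  have hB: "mat_adjoint B = B" unfolding B_def using U A hA
    by (simp add: mat_adjoint_mult mult_mat_assoc)
  have AB: "A = U * B * mat_adjoint U" unfolding B_def using U A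
    by (simp add: mult_mat_assoc UU' mult_cancel_inverse[OF UU'])
  have "col B 0 = mat_adjoint U *\<^sub>v (A *\<^sub>v col U 0)"
  proof -
    have *: "dim_col (mat_adjoint U) = dim_row A" "dim_col A = dim_row U" using U A by auto
    have "col B 0 = mat_adjoint U *\<^sub>v col (A * U) 0"
      unfolding B_def mult_mat_assoc[OF *] by (rule col_mult2[of _ "Suc m" "Suc m" _ "Suc m"]) (use U A in auto)
    also have "col (A * U) 0 = A *\<^sub>v col U 0"
      by (rule col_mult2[OF A U]) simp
    finally show ?thesis .
  qed
  also have "A *\<^sub>v col U 0 = e \<cdot>\<^sub>v col U 0"
    unfolding col0 using A v by (simp add: mult_mat_vec smult_smult_assoc mult.commute)
  also have "mat_adjoint U *\<^sub>v \<dots> = e \<cdot>\<^sub>v (mat_adjoint U *\<^sub>v col U 0)"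
    by (rule mult_mat_vec[of _ "Suc m" "Suc m"]) (use U in \<open>auto intro: carrier_vecI\<close>)
  also have "mat_adjoint U *\<^sub>v col U 0 = col (1\<^sub>m (Suc m)) 0"
    unfolding UU[symmetric] using U by (simp add: col_mult2[of _ "Suc m" "Suc m" _ "Suc m"])
  finally have colB: "col B 0 = e \<cdot>\<^sub>v unit_vec (Suc m) 0" by simp
  have B0: "B $$ (i, 0) = (if i = 0 then e else 0)" if "i < Suc m" for i
    using arg_cong[OF colB, of "\<lambda>v. v $ i"] that B by auto
  have Bsym: "B $$ (i, j) = cnj (B $$ (j, i))" if "i < Suc m" "j < Suc m" for i j
    using arg_cong[OF hB, of "\<lambda>v. v $$ (i, j)"] that B by auto
  \<comment> \<open>The corner entry of a Hermitian matrix is real; the symmetry \<open>Bsym\<close>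
    also clears the first row.\<close>
  have e: "e = of_real (Re e)" using Bsym[of 0 0] B0[of 0] by (simp add: complex_eq_iff)
  define C where "C = mat m m (\<lambda>(i, j). B $$ (Suc i, Suc j))"
  have C: "C \<in> carrier_mat m m" unfolding C_def by auto
  have hC: "mat_adjoint C = C" by (rule eq_matI) (auto simp: C_def Bsym[symmetric])
  from Suc(1)[OF C hC] obtain V d where V: "V \<in> carrier_mat m m" "mat_adjoint V * V = 1\<^sub>m m"
    and CV: "C = V * real_diag m d * mat_adjoint V" by auto
  \<comment> \<open>Prepends the split-off eigenvalue to those of the trailing block
    \<open>C\<close>; \<open>W\<close> extends \<open>V\<close> in the same way.\<close>
  define d' where "d' i = (case i of 0 \<Rightarrow> Re e | Suc i \<Rightarrow> d i)" for i
  define W where "W = four_block_mat (1\<^sub>m 1) (0\<^sub>m 1 m) (0\<^sub>m m 1) V"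
  have W: "W \<in> carrier_mat (Suc m) (Suc m)" unfolding W_def using V by auto
  have adjW: "mat_adjoint W = four_block_mat (1\<^sub>m 1) (0\<^sub>m 1 m) (0\<^sub>m m 1) (mat_adjoint V)"
    unfolding W_def using V by (subst mat_adjoint_four_block) auto
  have WW: "mat_adjoint W * W = 1\<^sub>m (Suc m)"
    unfolding adjW unfolding W_def using V
    by (subst mult_four_block_mat) (auto simp: four_block_one_mat[of 1 m, simplified])
  have diag: "real_diag (Suc m) d' = four_block_mat (of_real (Re e) \<cdot>\<^sub>m 1\<^sub>m 1) (0\<^sub>m 1 m) (0\<^sub>m m 1) (real_diag m d)"
    by (rule eq_matI) (auto simp: real_diag_def d'_def split: nat.splits)
  have "B = four_block_mat (of_real (Re e) \<cdot>\<^sub>m 1\<^sub>m 1) (0\<^sub>m 1 m) (0\<^sub>m m 1) C"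
  proof (rule eq_matI)
    fix i j
    assume "i < dim_row (four_block_mat (of_real (Re e) \<cdot>\<^sub>m 1\<^sub>m 1) (0\<^sub>m 1 m) (0\<^sub>m m 1) C)"
      "j < dim_col (four_block_mat (of_real (Re e) \<cdot>\<^sub>m 1\<^sub>m 1) (0\<^sub>m 1 m) (0\<^sub>m m 1) C)"
    then have ij: "i < Suc m" "j < Suc m" using C by auto
    show "B $$ (i, j) = four_block_mat (of_real (Re e) \<cdot>\<^sub>m 1\<^sub>m 1) (0\<^sub>m 1 m) (0\<^sub>m m 1) C $$ (i, j)"
      using ij B0[of i] B0[of j] Bsym[of i j] e C by (cases i; cases j) (auto simp: C_def)
  qed (use B C in auto)
  also have "\<dots> = W * real_diag (Suc m) d' * mat_adjoint W"
    unfolding adjW diag unfolding W_def CV using V mult_carrier_mat[OF mult_carrier_mat[OF V(1) real_diag_carrier, of d]]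
    by (simp add: mult_four_block_mat[of _ 1 1 _ m _ m _ _ 1 _ m])
  finally have "A = U * (W * real_diag (Suc m) d' * mat_adjoint W) * mat_adjoint U"
    using AB by simp
  then have "A = (U * W) * real_diag (Suc m) d' * mat_adjoint (U * W)"
    using U W by (simp add: mat_adjoint_mult mult_mat_assoc)
  moreover have "mat_adjoint (U * W) * (U * W) = 1\<^sub>m (Suc m)"
    using U W WW by (simp add: mat_adjoint_mult mult_mat_assoc mult_cancel_inverse[OF UU])
  ultimately show ?case using U W by (intro exI[of _ "U * W"] exI[of _ d']) auto
qed


text \<open>The columns of \<open>U\<close> form an orthonormal eigenbasis, so each
  \<open>d i\<close> can be studied through the quadratic form at a unit vector.\<close>

lemma unitary_diagonal_col:
  assumes U: "U \<in> carrier_mat n n" and UU: "mat_adjoint U * U = (1\<^sub>m n :: complex mat)" and i: "i < n"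
  shows "(U * real_diag n d * mat_adjoint U) *\<^sub>v col U i = of_real (d i) \<cdot>\<^sub>v col U i"
    and "col U i \<bullet>c col U i = 1"
proof -
  let ?A = "U * real_diag n d * mat_adjoint U"
  have "?A *\<^sub>v col U i = col (?A * U) i"
    using U i by (subst col_mult2[of _ n n _ n]) auto
  also have "?A * U = U * real_diag n d"
    using U by (simp add: mult_mat_assoc UU)
  also have "col (U * real_diag n d) i = of_real (d i) \<cdot>\<^sub>v col U i"
    by (rule eq_vecI)
      (use U i in \<open>auto simp: real_diag_def scalar_prod_def if_distrib[of "\<lambda>x. _ * x"] cong: if_cong\<close>)
  finally show "?A *\<^sub>v col U i = of_real (d i) \<cdot>\<^sub>v col U i" .
  have "col U i \<bullet>c col U i = (mat_adjoint U * U) $$ (i, i)"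
    using U i by (auto simp: scalar_prod_def mult.commute)
  then show "col U i \<bullet>c col U i = 1" using UU i by simp
qed

section \<open>Positive semidefinite matrices and their square roots\<close>

lemma hermitian_matI: "A \<in> carrier_mat n n \<Longrightarrow> mat_adjoint A = A \<Longrightarrow> hermitian_mat A"
  by (auto simp: hermitian_mat_def)

lemma pos_def_imp_pos_semidef:
  assumes "pos_def_mat A"
  shows "pos_semidef_mat A"
proof -
  have "0 \<le> Re ((A *\<^sub>v v) \<bullet>c v)" if "v \<in> carrier_vec (dim_row A)" for v
  proof (cases "v = 0\<^sub>v (dim_row A)")
    case True
    then show ?thesis by (auto simp: scalar_prod_def)
  next
    case False
    then show ?thesis using assms that by (auto simp: pos_def_mat_def intro: less_imp_le)
  qed
  then show ?thesis using assms by (auto simp: pos_semidef_mat_def pos_def_mat_def)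
qed

text \<open>As \<open>X\<close> is self-adjoint, the form of \<open>X * X\<close> at
  \<open>v\<close> is the squared norm of \<open>X *\<^sub>v v\<close>.\<close>

lemma pos_semidef_hermitian_square:
  assumes X: "X \<in> carrier_mat n n" and hX: "mat_adjoint X = X"
  shows "pos_semidef_mat (X * X)"
proof -
  have "(X * X *\<^sub>v v) \<bullet>c v = (X *\<^sub>v v) \<bullet>c (X *\<^sub>v v)" if "v \<in> carrier_vec n" for v
    using mult_mat_vec_cscalar_prod[OF X _ that, of "X *\<^sub>v v"] that X hX by simp
  then show ?thesis
    using X hX Re_cscalar_prod_self(1)[of "X *\<^sub>v _" n]
    by (auto simp: pos_semidef_mat_def mat_adjoint_mult intro!: hermitian_matI)
qed

text \<open>Take a Hermitian fourth root \<open>X\<close>: its square \<open>X * X\<close> is the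
  wanted root, and it is positive semidefinite as the square of a Hermitian matrix.\<close>

lemma pos_semidef_sqrt_exists:
  assumes A: "A \<in> carrier_mat n n" and psd: "pos_semidef_mat A"
  shows "\<exists>B. pos_semidef_mat B \<and> B * B = A"
proof -
  from psd have "mat_adjoint A = A" by (auto simp: pos_semidef_mat_def hermitian_mat_def)
  from hermitian_unitarily_diagonalizable[OF A this] obtain U d where
    U: "U \<in> carrier_mat n n" and UU: "mat_adjoint U * U = 1\<^sub>m n"
    and AU: "A = U * real_diag n d * mat_adjoint U" by auto
  \<comment> \<open>\<open>d i\<close> is the value of the form of \<open>A\<close> at the unit
    vector \<open>col U i\<close>.\<close>
  have d: "0 \<le> d i" if i: "i < n" for i
  proof -
    have c: "col U i \<in> carrier_vec n" using U by auto
    have "(A *\<^sub>v col U i) \<bullet>c col U i = of_real (d i)"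
      unfolding AU unitary_diagonal_col(1)[OF U UU i] using unitary_diagonal_col(2)[OF U UU i] U by simp
    then show ?thesis using psd A c by (auto simp: pos_semidef_mat_def dest!: bspec[of _ _ "col U i"])
  qed
  define X where "X = U * real_diag n (\<lambda>i. sqrt (sqrt (d i))) * mat_adjoint U"
  have X: "X \<in> carrier_mat n n" unfolding X_def using U by auto
  have hX: "mat_adjoint X = X" unfolding X_def using U by (simp add: mat_adjoint_mult mult_mat_assoc)
  have "(X * X) * (X * X) = U * (real_diag n (\<lambda>i. sqrt (sqrt (d i))) * (real_diag n (\<lambda>i. sqrt (sqrt (d i)))
     * (real_diag n (\<lambda>i. sqrt (sqrt (d i))) * real_diag n (\<lambda>i. sqrt (sqrt (d i)))))) * mat_adjoint U"
    unfolding X_def using U by (simp add: mult_mat_assoc mult_cancel_inverse[OF UU])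
  also have "real_diag n (\<lambda>i. sqrt (sqrt (d i))) * (real_diag n (\<lambda>i. sqrt (sqrt (d i)))
     * (real_diag n (\<lambda>i. sqrt (sqrt (d i))) * real_diag n (\<lambda>i. sqrt (sqrt (d i))))) = real_diag n d"
    unfolding real_diag_mult unfolding real_diag_def
    by (rule cong_mat) (auto simp: d mult.assoc[symmetric] simp flip: of_real_mult)
  finally show ?thesis using pos_semidef_hermitian_square[OF X hX] AU by metis
qed

text \<open>Diagonalising only the Hermitian difference \<open>B - C\<close> avoids a common
  eigenbasis; all its eigenvalues turn out to be zero.\<close>

lemma pos_semidef_sqrt_unique:
  assumes psd: "pos_semidef_mat B" "pos_semidef_mat C" and eq: "B * B = C * C"
  shows "B = C"
proof -
  define n where "n = dim_row B"
  have hB: "mat_adjoint B = B" and hC: "mat_adjoint C = C"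
    using psd by (auto simp: pos_semidef_mat_def hermitian_mat_def)
  have B: "B \<in> carrier_mat n n"
    using psd by (auto simp: pos_semidef_mat_def hermitian_mat_def n_def)
  have "dim_row C = n" using arg_cong[OF eq, of dim_row] by (simp add: n_def)
  then have C: "C \<in> carrier_mat n n"
    using psd by (auto simp: pos_semidef_mat_def hermitian_mat_def)
  let ?D = "B - C"
  have D: "?D \<in> carrier_mat n n" using B C by auto
  have hD: "mat_adjoint ?D = ?D" using B C hB hC by (simp add: mat_adjoint_minus)
  from hermitian_unitarily_diagonalizable[OF D hD] obtain U d where
    U: "U \<in> carrier_mat n n" and UU: "mat_adjoint U * U = 1\<^sub>m n"
    and DU: "?D = U * real_diag n d * mat_adjoint U" by auto
  \<comment> \<open>For an eigenpair \<open>(d i, u)\<close> of \<open>B - C\<close>, \<open>B\<^sup>2 = C\<^sup>2\<close> forces \<open>d i * (u\<^sup>* B u + u\<^sup>* C u) = 0\<close>,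
    while \<open>d i = u\<^sup>* B u - u\<^sup>* C u\<close>.\<close>
  have d0: "d i = 0" if i: "i < n" for i
  proof (rule ccontr)
    assume nz: "d i \<noteq> 0"
    define u where "u = col U i"
    have u: "u \<in> carrier_vec n" using U by (auto simp: u_def)
    have Du: "?D *\<^sub>v u = of_real (d i) \<cdot>\<^sub>v u"
      unfolding DU u_def by (rule unitary_diagonal_col(1)[OF U UU i])
    have uu: "u \<bullet>c u = 1" unfolding u_def by (rule unitary_diagonal_col(2)[OF U UU i])
    define \<beta> where "\<beta> = (B *\<^sub>v u) \<bullet>c u"
    define \<gamma> where "\<gamma> = (C *\<^sub>v u) \<bullet>c u"
    have Bu: "B *\<^sub>v u \<in> carrier_vec n" and Cu: "C *\<^sub>v u \<in> carrier_vec n" using B C u by auto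
    have BC: "B *\<^sub>v u = C *\<^sub>v u + of_real (d i) \<cdot>\<^sub>v u"
    proof -
      have "?D *\<^sub>v u = B *\<^sub>v u - C *\<^sub>v u" by (rule minus_mult_distrib_mat_vec[OF B C u])
      then have *: "B *\<^sub>v u - C *\<^sub>v u = of_real (d i) \<cdot>\<^sub>v u" using Du by simp
      show ?thesis
      proof (rule eq_vecI)
        fix j assume "j < dim_vec (C *\<^sub>v u + of_real (d i) \<cdot>\<^sub>v u)"
        then show "(B *\<^sub>v u) $ j = (C *\<^sub>v u + of_real (d i) \<cdot>\<^sub>v u) $ j"
          using arg_cong[OF *, of "\<lambda>v. v $ j"] B C u by (simp add: algebra_simps del: index_mult_mat_vec)
      qed (use B C u in auto)
    qed
    have 1: "\<beta> = \<gamma> + of_real (d i)"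
      unfolding \<beta>_def BC \<gamma>_def using Cu u uu by (simp add: add_scalar_prod_distrib[of _ n])
    have "(B * B *\<^sub>v u) \<bullet>c u = (C * C *\<^sub>v u) \<bullet>c u" using eq by simp
    \<comment> \<open>Moving one Hermitian factor across the inner product turns equal squares into
      equal norms of \<open>B *\<^sub>v u\<close> and \<open>C *\<^sub>v u\<close>.\<close>
    then have "(B *\<^sub>v u) \<bullet>c (B *\<^sub>v u) = (C *\<^sub>v u) \<bullet>c (C *\<^sub>v u)"
      using mult_mat_vec_cscalar_prod[OF B Bu u] mult_mat_vec_cscalar_prod[OF C Cu u] hB hC B C u by simp
    moreover have "u \<bullet>c (C *\<^sub>v u) = \<gamma>"
      unfolding \<gamma>_def using mult_mat_vec_cscalar_prod[OF C u u] hC by simp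
    ultimately have "of_real (d i) * \<gamma> + of_real (d i) * \<gamma> + of_real (d i) * of_real (d i) = (0 :: complex)"
      unfolding BC using Cu u uu
      by (simp add: add_scalar_prod_distrib[of _ n] scalar_prod_add_distrib[of _ n] conjugate_add_vec[of _ n]
        conjugate_smult_vec \<gamma>_def[symmetric] algebra_simps)
    then have "complex_of_real (d i) * (\<beta> + \<gamma>) = 0" unfolding 1 by (simp add: algebra_simps)
    then have "\<beta> + \<gamma> = 0" using nz by simp
    moreover have "0 \<le> Re \<beta>" "0 \<le> Re \<gamma>"
      using psd B C u by (auto simp: pos_semidef_mat_def \<beta>_def \<gamma>_def)
    ultimately have "Re \<beta> = 0" "Re \<gamma> = 0" by (auto simp: complex_eq_iff)
    then show False using 1 nz by simp
  qed
  have "real_diag n d = 0\<^sub>m n n" by (rule eq_matI) (auto simp: real_diag_def d0)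
  then have "?D = 0\<^sub>m n n" unfolding DU using U by simp
  show ?thesis
  proof (rule eq_matI)
    fix i j assume "i < dim_row C" "j < dim_col C"
    then show "B $$ (i, j) = C $$ (i, j)"
      using arg_cong[OF \<open>?D = 0\<^sub>m n n\<close>, of "\<lambda>M. M $$ (i, j)"] B C by auto
  qed (use B C in auto)
qed

lemma mat_sqrt:
  assumes "A \<in> carrier_mat n n" "pos_semidef_mat A"
  shows "pos_semidef_mat (mat_sqrt A)" "mat_sqrt A * mat_sqrt A = A"
proof -
  have "\<exists>!B. pos_semidef_mat B \<and> B * B = A"
    using pos_semidef_sqrt_exists[OF assms] pos_semidef_sqrt_unique by metis
  from theI'[OF this, folded mat_sqrt_def]
  show "pos_semidef_mat (mat_sqrt A)" "mat_sqrt A * mat_sqrt A = A" by auto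
qed

section \<open>Inverses and inverse square roots\<close>

text \<open>A one-sided inverse of a square matrix is two-sided, so \<open>mat_inverse\<close>
  succeeds, and its result agrees with \<open>B\<close> by uniqueness of inverses.\<close>

lemma mat_inv_eqI:
  assumes A: "A \<in> carrier_mat n n" and B: "B \<in> carrier_mat n n" and AB: "A * B = 1\<^sub>m n"
  shows "mat_inv A = B"
proof -
  have BA: "B * A = 1\<^sub>m n" by (rule mat_mult_left_right_inverse[OF A B AB])
  then have "A \<in> Units (ring_mat TYPE(complex) n undefined)"
    using A B AB by (auto simp: Units_def ring_mat_simps)
  then obtain C where C: "mat_inverse A = Some C"
    using mat_inverse(1)[OF A, of undefined] by (cases "mat_inverse A") auto
  from mat_inverse(2)[OF A C] have AC: "A * C = 1\<^sub>m n" "C \<in> carrier_mat n n" by auto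
  have "B = B * (A * C)" using AC B by simp
  also have "\<dots> = C" using mult_cancel_inverse[OF BA, of C] A B AC by auto
  finally show ?thesis unfolding mat_inv_def C by simp
qed

text \<open>A nonzero kernel vector would give the form the value zero, so the determinant is
  nonzero.\<close>

lemma pos_def_invertible:
  assumes A: "A \<in> carrier_mat n n" and pd: "pos_def_mat A"
  shows "\<exists>B \<in> carrier_mat n n. A * B = 1\<^sub>m n"
proof -
  have "det A \<noteq> 0"
  proof
    assume "det A = 0"
    then obtain v where v: "v \<in> carrier_vec n" "v \<noteq> 0\<^sub>v n" "A *\<^sub>v v = 0\<^sub>v n"
      using det_0_iff_vec_prod_zero[OF A] by auto
    then have "0 < Re ((A *\<^sub>v v) \<bullet>c v)" using pd A by (auto simp: pos_def_mat_def)
    then show False using v by simp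
  qed
  from det_non_zero_imp_unit[OF A this, of undefined] show ?thesis
    by (auto simp: Units_def ring_mat_simps)
qed

text \<open>Hides \<open>mat_sqrt\<close> behind a Hermitian root \<open>s\<close>, together with
  the cancellation rules for the inverse square root.\<close>

lemma mat_inv_sqrt:
  assumes A: "A \<in> carrier_mat n n" and pd: "pos_def_mat A"
  obtains s where "s \<in> carrier_mat n n" "mat_inv_sqrt A \<in> carrier_mat n n"
    "mat_adjoint s = s" "mat_adjoint (mat_inv_sqrt A) = mat_inv_sqrt A"
    "A = s * s" "s * mat_inv_sqrt A = 1\<^sub>m n" "mat_inv_sqrt A * s = 1\<^sub>m n"
proof -
  define s where "s = mat_sqrt A"
  note s = mat_sqrt[OF A pos_def_imp_pos_semidef[OF pd], folded s_def]
  have hs: "mat_adjoint s = s" and sq: "dim_row s = dim_col s"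
    using s by (auto simp: pos_semidef_mat_def hermitian_mat_def)
  have sc: "s \<in> carrier_mat n n" using s(2) A sq by (metis carrier_matD(1) carrier_matI index_mult_mat(2))
  from pos_def_invertible[OF A pd] obtain B where B: "B \<in> carrier_mat n n" "A * B = 1\<^sub>m n" by auto
  \<comment> \<open>Since \<open>s * s = A\<close>, a right inverse of \<open>s\<close> is
    \<open>s\<close> times one of \<open>A\<close>.\<close>
  define r where "r = s * B"
  have r: "r \<in> carrier_mat n n" unfolding r_def using sc B by auto
  have sr: "s * r = 1\<^sub>m n" unfolding r_def using sc B s(2) by (simp add: mult_mat_assoc[symmetric])
  have rs: "r * s = 1\<^sub>m n" by (rule mat_mult_left_right_inverse[OF sc r sr])
  have inv: "mat_inv_sqrt A = r" unfolding mat_inv_sqrt_def s_def[symmetric] by (rule mat_inv_eqI[OF sc r sr])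
  \<comment> \<open>The adjoint of \<open>r\<close> also inverts the Hermitian \<open>s\<close>, and
    inverses are unique.\<close>
  have hr: "mat_adjoint r = r"
  proof -
    have "s * mat_adjoint r = 1\<^sub>m n"
      using arg_cong[OF rs, of mat_adjoint] r sc hs by (simp add: mat_adjoint_mult)
    then have "mat_inv s = mat_adjoint r" by (intro mat_inv_eqI[of _ n]) (use r sc in auto)
    with mat_inv_eqI[OF sc r sr] show ?thesis by simp
  qed
  show ?thesis by (rule that[of s, unfolded inv, OF sc r hs hr s(2)[symmetric] sr rs])
qed

section \<open>Positive definite block matrices\<close>

lemma cscalar_prod_append:
  assumes "x \<in> carrier_vec p" "x' \<in> carrier_vec p" "y \<in> carrier_vec q" "y' \<in> carrier_vec q"
  shows "(x @\<^sub>v y) \<bullet>c (x' @\<^sub>v y') = x \<bullet>c x' + y \<bullet>c (y' :: complex vec)"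
proof -
  have "conjugate (x' @\<^sub>v y') = conjugate x' @\<^sub>v conjugate y'"
    by (rule eq_vecI) auto
  then show ?thesis using assms by (simp add: scalar_prod_append[of _ p _ q])
qed

lemma append_vec_eq_zero_iff:
  assumes "x \<in> carrier_vec p" "y \<in> carrier_vec q"
  shows "x @\<^sub>v y = 0\<^sub>v (p + q) \<longleftrightarrow> x = 0\<^sub>v p \<and> y = (0\<^sub>v q :: complex vec)"
proof -
  have "0\<^sub>v (p + q) = 0\<^sub>v p @\<^sub>v (0\<^sub>v q :: complex vec)" by (rule eq_vecI) auto
  then show ?thesis using append_vec_eq[of x p "0\<^sub>v p" y "0\<^sub>v q"] assms by auto
qed

text \<open>Splits the form at \<open>x @\<^sub>v y\<close> into two contributions, so that suitable
  choices of \<open>x\<close> and \<open>y\<close> isolate a diagonal block or a Schur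
  complement.\<close>

lemma pos_def_four_block_form:
  assumes P: "P \<in> carrier_mat p p" and Q: "Q \<in> carrier_mat p q" and S: "S \<in> carrier_mat q q"
    and pd: "pos_def_mat (four_block_mat P Q (mat_adjoint Q) S)"
    and x: "x \<in> carrier_vec p" and y: "y \<in> carrier_vec q" and nz: "x \<noteq> 0\<^sub>v p \<or> y \<noteq> 0\<^sub>v q"
  shows "0 < Re ((P *\<^sub>v x + Q *\<^sub>v y) \<bullet>c x + (mat_adjoint Q *\<^sub>v x + S *\<^sub>v y) \<bullet>c y)"
proof -
  let ?K = "four_block_mat P Q (mat_adjoint Q) S"
  have Q': "mat_adjoint Q \<in> carrier_mat q p" using Q by simp
  have "0 < Re ((?K *\<^sub>v (x @\<^sub>v y)) \<bullet>c (x @\<^sub>v y))"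
    using pd P S x y nz append_vec_eq_zero_iff[OF x y] by (auto simp: pos_def_mat_def)
  also have "(?K *\<^sub>v (x @\<^sub>v y)) \<bullet>c (x @\<^sub>v y)
    = (P *\<^sub>v x + Q *\<^sub>v y) \<bullet>c x + (mat_adjoint Q *\<^sub>v x + S *\<^sub>v y) \<bullet>c y"
    unfolding four_block_mat_mult_vec[OF P Q Q' S x y]
    by (rule cscalar_prod_append[of _ p _ _ q]) (use P Q Q' S x y in \<open>auto intro!: add_carrier_vec mult_mat_vec_carrier\<close>)
  finally show ?thesis .
qed

text \<open>Stacked vectors with one part zero see a single diagonal block; the symmetry of the
  blocks is read off entrywise from that of the whole matrix.\<close>

lemma pos_def_diagonal_blocks:
  assumes P: "P \<in> carrier_mat p p" and Q: "Q \<in> carrier_mat p q" and S: "S \<in> carrier_mat q q"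
    and pd: "pos_def_mat (four_block_mat P Q (mat_adjoint Q) S)"
  shows "pos_def_mat P" "pos_def_mat S"
proof -
  let ?K = "four_block_mat P Q (mat_adjoint Q) S"
  have Q': "mat_adjoint Q \<in> carrier_mat q p" using Q by simp
  have hK: "mat_adjoint ?K = ?K" using pd by (auto simp: pos_def_mat_def hermitian_mat_def)
  have hP: "mat_adjoint P = P"
  proof (rule eq_matI)
    fix i j assume "i < dim_row P" "j < dim_col P"
    then show "mat_adjoint P $$ (i, j) = P $$ (i, j)"
      using arg_cong[OF hK, of "\<lambda>M. M $$ (i, j)"] P S by auto
  qed (use P in auto)
  have hS: "mat_adjoint S = S"
  proof (rule eq_matI)
    fix i j assume "i < dim_row S" "j < dim_col S"
    then show "mat_adjoint S $$ (i, j) = S $$ (i, j)"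
      using arg_cong[OF hK, of "\<lambda>M. M $$ (p + i, p + j)"] P S by auto
  qed (use S in auto)
  show "pos_def_mat P"
    using pos_def_four_block_form[OF P Q S pd, of _ "0\<^sub>v q"] P Q Q' S hP
    by (auto simp: pos_def_mat_def intro!: hermitian_matI)
  show "pos_def_mat S"
    using pos_def_four_block_form[OF P Q S pd, of "0\<^sub>v p"] P Q Q' S hS
    by (auto simp: pos_def_mat_def intro!: hermitian_matI)
qed

text \<open>The two matrices are the Schur complements of the identity blocks.\<close>

lemma pos_def_unit_blocks_contraction:
  assumes R: "R \<in> carrier_mat p q" and pd: "pos_def_mat (four_block_mat (1\<^sub>m p) R (mat_adjoint R) (1\<^sub>m q))"
  shows "pos_def_mat (1\<^sub>m p - R * mat_adjoint R)" "pos_def_mat (1\<^sub>m q - mat_adjoint R * R)"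
proof -
  have R': "mat_adjoint R \<in> carrier_mat q p" using R by simp
  have "0 < Re (((1\<^sub>m p - R * mat_adjoint R) *\<^sub>v x) \<bullet>c x)" if x: "x \<in> carrier_vec p" and nz: "x \<noteq> 0\<^sub>v p" for x
  proof -
    \<comment> \<open>This choice annihilates the lower component of the image, so the form reduces
      to that of the Schur complement at \<open>x\<close>.\<close>
    define y where "y = - (mat_adjoint R *\<^sub>v x)"
    have y: "y \<in> carrier_vec q" using R' x by (auto simp: y_def)
    have "1\<^sub>m p *\<^sub>v x + R *\<^sub>v y = (1\<^sub>m p - R * mat_adjoint R) *\<^sub>v x"
      unfolding y_def using R R' x
      by (subst minus_mult_distrib_mat_vec[of _ p p]) (auto simp: minus_add_uminus_vec[of _ p] mult_mat_vec_assoc)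
    moreover have "mat_adjoint R *\<^sub>v x + 1\<^sub>m q *\<^sub>v y = 0\<^sub>v q"
      using R' x y by (simp add: y_def)
    ultimately show ?thesis
      using pos_def_four_block_form[OF one_carrier_mat R one_carrier_mat pd x y] nz y by simp
  qed
  then show "pos_def_mat (1\<^sub>m p - R * mat_adjoint R)"
    using R by (auto simp: pos_def_mat_def mat_adjoint_minus mat_adjoint_mult intro!: hermitian_matI)
  have "0 < Re (((1\<^sub>m q - mat_adjoint R * R) *\<^sub>v y) \<bullet>c y)" if y: "y \<in> carrier_vec q" and nz: "y \<noteq> 0\<^sub>v q" for y
  proof -
    \<comment> \<open>The mirrored choice: now the upper component vanishes.\<close>
    define x where "x = - (R *\<^sub>v y)"
    have x: "x \<in> carrier_vec p" using R y by (auto simp: x_def)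
    have "mat_adjoint R *\<^sub>v x + 1\<^sub>m q *\<^sub>v y = (1\<^sub>m q - mat_adjoint R * R) *\<^sub>v y"
      unfolding x_def using R R' y
      by (subst minus_mult_distrib_mat_vec[of _ q q]) (auto simp: minus_add_uminus_vec[of _ q] comm_add_vec[of _ q] mult_mat_vec_assoc)
    moreover have "1\<^sub>m p *\<^sub>v x + R *\<^sub>v y = 0\<^sub>v p"
      using R x y by (simp add: x_def)
    ultimately show ?thesis
      using pos_def_four_block_form[OF one_carrier_mat R one_carrier_mat pd x y] nz x by simp
  qed
  then show "pos_def_mat (1\<^sub>m q - mat_adjoint R * R)"
    using R by (auto simp: pos_def_mat_def mat_adjoint_minus mat_adjoint_mult intro!: hermitian_matI)
qed

text \<open>The transformed form at \<open>v\<close> is the old form at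
  \<open>X *\<^sub>v v\<close>, and the left inverse \<open>Y\<close> keeps this vector
  nonzero.\<close>

lemma pos_def_congruence:
  assumes A: "A \<in> carrier_mat n n" and pd: "pos_def_mat A" and X: "X \<in> carrier_mat n n" and Y: "Y \<in> carrier_mat n n"
    and YX: "Y * X = 1\<^sub>m n"
  shows "pos_def_mat (mat_adjoint X * A * X)"
proof -
  have hA: "mat_adjoint A = A" using pd by (auto simp: pos_def_mat_def hermitian_mat_def)
  have "0 < Re ((mat_adjoint X * A * X *\<^sub>v v) \<bullet>c v)" if v: "v \<in> carrier_vec n" "v \<noteq> 0\<^sub>v n" for v
  proof -
    have Xv: "X *\<^sub>v v \<in> carrier_vec n" using X v by auto
    have "X *\<^sub>v v \<noteq> 0\<^sub>v n"
    proof
      assume "X *\<^sub>v v = 0\<^sub>v n"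
      then have "(Y * X) *\<^sub>v v = 0\<^sub>v n" using X Y v by simp
      then show False using YX v by simp
    qed
    then have "0 < Re ((A *\<^sub>v (X *\<^sub>v v)) \<bullet>c (X *\<^sub>v v))" using pd A Xv by (auto simp: pos_def_mat_def)
    also have "(A *\<^sub>v (X *\<^sub>v v)) \<bullet>c (X *\<^sub>v v) = (mat_adjoint X * A * X *\<^sub>v v) \<bullet>c v"
      using mult_mat_vec_cscalar_prod[of "mat_adjoint X" n n "A *\<^sub>v (X *\<^sub>v v)" v] A X v by (simp add: mult_mat_vec_assoc)
    finally show ?thesis .
  qed
  then show ?thesis using A X hA
    by (auto simp: pos_def_mat_def mat_adjoint_mult mult_mat_assoc intro!: hermitian_matI)
qed


section \<open>Block identities and the indefinite unitary group\<close>

text \<open>Serves the block diagonal scaling of a matrix to unit diagonal blocks.\<close>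

lemma mult_four_block_mat_diag:
  fixes A D :: "complex mat"
  assumes "X1 \<in> carrier_mat p p" "X2 \<in> carrier_mat q q" "Y1 \<in> carrier_mat p p" "Y2 \<in> carrier_mat q q"
    "A \<in> carrier_mat p p" "B \<in> carrier_mat p q" "C \<in> carrier_mat q p" "D \<in> carrier_mat q q"
  shows "four_block_mat X1 (0\<^sub>m p q) (0\<^sub>m q p) X2 * four_block_mat A B C D * four_block_mat Y1 (0\<^sub>m p q) (0\<^sub>m q p) Y2
    = four_block_mat (X1 * A * Y1) (X1 * B * Y2) (X2 * C * Y1) (X2 * D * Y2)"
  using assms by (simp add: mult_four_block_mat[of _ p p _ q _ q _ _ p _ q])

lemma four_block_mat_eq_iff:
  assumes "A \<in> carrier_mat p p'" "B \<in> carrier_mat p q'" "C \<in> carrier_mat q p'" "D \<in> carrier_mat q q'"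
    and "A' \<in> carrier_mat p p'" "B' \<in> carrier_mat p q'" "C' \<in> carrier_mat q p'" "D' \<in> carrier_mat q q'"
  shows "four_block_mat A B C D = four_block_mat A' B' C' D' \<longleftrightarrow> A = A' \<and> B = B' \<and> C = C' \<and> D = D'"
proof
  assume eq: "four_block_mat A B C D = four_block_mat A' B' C' D'"
  note idx = arg_cong[OF eq, of "\<lambda>M. M $$ _"]
  have "A $$ (i, j) = A' $$ (i, j)" if "i < p" "j < p'" for i j
    using idx[of "(i, j)"] that assms by auto
  moreover have "B $$ (i, j) = B' $$ (i, j)" if "i < p" "j < q'" for i j
    using idx[of "(i, p' + j)"] that assms by auto
  moreover have "C $$ (i, j) = C' $$ (i, j)" if "i < q" "j < p'" for i j
    using idx[of "(p + i, j)"] that assms by auto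
  moreover have "D $$ (i, j) = D' $$ (i, j)" if "i < q" "j < q'" for i j
    using idx[of "(p + i, p' + j)"] that assms by auto
  ultimately show "A = A' \<and> B = B' \<and> C = C' \<and> D = D'"
    using assms by (intro conjI eq_matI) auto
qed auto

lemma corner_four_block_mat [simp]:
  "A \<in> carrier_mat n n \<Longrightarrow> corner n (four_block_mat A B C D) = A"
  by (rule eq_matI) (auto simp: corner_def)

lemma lower_right_block_four_block_mat [simp]:
  "A \<in> carrier_mat p p \<Longrightarrow> D \<in> carrier_mat n n \<Longrightarrow> lower_right_block n (four_block_mat A B C D) = D"
  by (rule eq_matI) (auto simp: lower_right_block_def)

lemma signature_mat_square: "signature_mat p q * signature_mat p q = 1\<^sub>m (p + q)"
  unfolding signature_mat_def
  by (subst mult_four_block_mat[of _ p p _ q _ q _ _ p _ q]) (auto intro!: eq_matI)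

text \<open>As the signature matrix is an involution, multiplying the defining equation by it
  exhibits a left inverse of \<open>M\<close>; invertibility follows.\<close>

lemma indef_unitary_groupI:
  assumes M: "M \<in> carrier_mat (p + q) (p + q)"
    and eq: "mat_adjoint M * signature_mat p q * M = signature_mat p q"
  shows "M \<in> indef_unitary_group p q"
proof -
  have J: "signature_mat p q \<in> carrier_mat (p + q) (p + q)"
    unfolding signature_mat_def by auto
  let ?L = "signature_mat p q * (mat_adjoint M * signature_mat p q)"
  have L: "?L \<in> carrier_mat (p + q) (p + q)" using J M by auto
  have LM: "?L * M = 1\<^sub>m (p + q)"
    using J M eq by (simp add: mult_mat_assoc signature_mat_square)
  then have "M * ?L = 1\<^sub>m (p + q)" by (rule mat_mult_left_right_inverse[OF L M])
  with LM M L have "invertible_mat M" by (auto simp: invertible_mat_def inverts_mat_def intro!: exI[of _ ?L])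
  then show ?thesis using M eq by (simp add: indef_unitary_group_def)
qed

text \<open>\<open>P\<close> and \<open>Q\<close> stand for the two inverse square roots, which
  enter only through symmetry and the normalising identities \<open>PP\<close> and
  \<open>QQ\<close>. These settle the diagonal blocks; the off-diagonal ones cancel by
  associativity.\<close>

lemma hyperbolic_block_in_indef_unitary_group:
  assumes F: "F \<in> carrier_mat p q" and P: "P \<in> carrier_mat p p" and Q: "Q \<in> carrier_mat q q"
    and hP: "mat_adjoint P = P" and hQ: "mat_adjoint Q = Q"
    and PP: "P * (1\<^sub>m p - F * mat_adjoint F) * P = 1\<^sub>m p"
    and QQ: "Q * (1\<^sub>m q - mat_adjoint F * F) * Q = 1\<^sub>m q"
  shows "four_block_mat P (F * Q) (mat_adjoint F * P) Q \<in> indef_unitary_group p q"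
proof (rule indef_unitary_groupI)
  let ?F' = "mat_adjoint F"
  let ?M = "four_block_mat P (F * Q) (?F' * P) Q"
  have F': "?F' \<in> carrier_mat q p" using F by simp
  have adj: "mat_adjoint ?M = four_block_mat P (P * F) (Q * ?F') Q"
    using F F' P Q hP hQ
    by (subst mat_adjoint_four_block[of _ p p _ q _ q]) (auto simp: mat_adjoint_mult)
  have "mat_adjoint ?M * signature_mat p q = four_block_mat P (- (P * F)) (Q * ?F') (- Q)"
    unfolding adj signature_mat_def using F F' P Q
    by (subst mult_four_block_mat[of _ p p _ q _ q _ _ p _ q]) auto
  also have "\<dots> * ?M = four_block_mat (P * P - P * F * (?F' * P)) (P * (F * Q) - P * F * Q)
      (Q * ?F' * P - Q * (?F' * P)) (Q * ?F' * (F * Q) - Q * Q)"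
    using F F' P Q
    by (subst mult_four_block_mat[of _ p p _ q _ q _ _ p _ q])
      (auto simp: minus_add_uminus_mat[of _ p p] minus_add_uminus_mat[of _ p q] minus_add_uminus_mat[of _ q p] minus_add_uminus_mat[of _ q q])
  also have "P * P - P * F * (?F' * P) = 1\<^sub>m p"
    using PP F F' P by (simp add: mult_minus_distrib_mat[of _ p p _ p] minus_mult_distrib_mat[of _ p p _ _ p] mult_mat_assoc)
  \<comment> \<open>The signature contributes the opposite sign here, so \<open>QQ\<close> yields
    minus the identity.\<close>
  also have "Q * ?F' * (F * Q) - Q * Q = - 1\<^sub>m q"
  proof -
    have "Q * Q - Q * ?F' * (F * Q) = 1\<^sub>m q"
      using QQ F F' Q by (simp add: mult_minus_distrib_mat[of _ q q _ q] minus_mult_distrib_mat[of _ q q _ _ q] mult_mat_assoc)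
    moreover have "Q * ?F' * (F * Q) - Q * Q = - (Q * Q - Q * ?F' * (F * Q))"
      by (rule eq_matI) (use F F' Q in auto)
    ultimately show ?thesis by simp
  qed
  also have "P * (F * Q) - P * F * Q = 0\<^sub>m p q" using F P Q by (simp add: mult_mat_assoc)
  also have "Q * ?F' * P - Q * (?F' * P) = 0\<^sub>m q p" using F P Q
    by (auto simp: mult_mat_assoc intro!: eq_matI)
  finally show "mat_adjoint ?M * signature_mat p q * ?M = signature_mat p q"
    by (simp add: signature_mat_def)
qed (use P Q in auto)

section \<open>The contraction, the group element and the similarity\<close>

theorem mainTheorem6:
  fixes N n :: nat and A A11 A12 A22 R F M Z :: "complex mat"
  assumes "1 \<le> n" and "2 * n \<le> N"
    and "A \<in> carrier_mat N N" and "pos_def_mat A"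
    and "A11 \<in> carrier_mat n n"
    and "A12 \<in> carrier_mat n (N - n)"
    and "A22 \<in> carrier_mat (N - n) (N - n)"
    and "A = four_block_mat A11 A12 (mat_adjoint A12) A22"
    and "R = mat_inv_sqrt A11 * A12 * mat_inv_sqrt A22"
    and "F = mat_adjoint R"
    and "M = four_block_mat
      (mat_inv_sqrt (1\<^sub>m (N - n) - F * mat_adjoint F))
      (F * mat_inv_sqrt (1\<^sub>m n - mat_adjoint F * F))
      (mat_adjoint F * mat_inv_sqrt (1\<^sub>m (N - n) - F * mat_adjoint F))
      (mat_inv_sqrt (1\<^sub>m n - mat_adjoint F * F))"
    and "Z = lower_right_block n M"
  shows "F \<in> carrier_mat (N - n) n
    \<and> loewner_less (mat_adjoint F * F) (1\<^sub>m n)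
    \<and> M \<in> indef_unitary_group (N - n) n
    \<and> Z * mat_adjoint Z = mat_inv (1\<^sub>m n - R * mat_adjoint R)
    \<and> similar_mat (corner n A * corner n (mat_inv A)) (Z * mat_adjoint Z)"
proof -
  \<comment> \<open>Size of the second block; as \<open>n\<close> is at most \<open>N\<close>, the
    truncated subtraction is exact.\<close>
  define k where "k = N - n"
  have N: "N = n + k" using assms(2) by (simp add: k_def)
  note A11 = assms(5) and A12 = assms(6)[folded k_def] and A22 = assms(7)[folded k_def]
  note R_def = assms(9) and F_def = assms(10) and M_def = assms(11)[folded k_def]
  let ?A21 = "mat_adjoint A12"
  have A: "A \<in> carrier_mat (n + k) (n + k)" using assms(3) N by simp
  have A21: "?A21 \<in> carrier_mat k n" using A12 by simp
  note pd = assms(4)[unfolded assms(8)]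
  note pd_blocks = pos_def_diagonal_blocks[OF A11 A12 A22 pd]
  obtain s where s: "s \<in> carrier_mat n n" "A11 = s * s" "s * mat_inv_sqrt A11 = 1\<^sub>m n"
    "mat_inv_sqrt A11 * s = 1\<^sub>m n" and "mat_inv_sqrt A11 \<in> carrier_mat n n"
    "mat_adjoint (mat_inv_sqrt A11) = mat_inv_sqrt A11"
    using mat_inv_sqrt[OF A11 pd_blocks(1)] by metis
  moreover define a where "a = mat_inv_sqrt A11"
  ultimately have sa: "s * a = 1\<^sub>m n" "a * s = 1\<^sub>m n" and a: "a \<in> carrier_mat n n" "mat_adjoint a = a" by auto
  obtain t where t: "t \<in> carrier_mat k k" "A22 = t * t" "t * mat_inv_sqrt A22 = 1\<^sub>m k"
    "mat_inv_sqrt A22 * t = 1\<^sub>m k" and "mat_inv_sqrt A22 \<in> carrier_mat k k"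
    "mat_adjoint (mat_inv_sqrt A22) = mat_inv_sqrt A22" "mat_adjoint t = t"
    using mat_inv_sqrt[OF A22 pd_blocks(2)] by metis
  moreover define b where "b = mat_inv_sqrt A22"
  ultimately have tb: "t * b = 1\<^sub>m k" "b * t = 1\<^sub>m k" and b: "b \<in> carrier_mat k k" "mat_adjoint b = b" by auto
  note R_def = R_def[folded a_def b_def]
  have R: "R \<in> carrier_mat n k" unfolding R_def using a b A12 by auto
  have R'_def: "mat_adjoint R = b * ?A21 * a"
    unfolding R_def using a b A12 by (simp add: mat_adjoint_mult mult_mat_assoc)
  have F: "F \<in> carrier_mat k n" and F': "mat_adjoint F = R" unfolding F_def using R by auto

  let ?T = "four_block_mat a (0\<^sub>m n k) (0\<^sub>m k n) b"
  let ?K = "four_block_mat (1\<^sub>m n) R (mat_adjoint R) (1\<^sub>m k)"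
  have hT: "mat_adjoint ?T = ?T"
    using a b by (subst mat_adjoint_four_block[of _ n n _ k _ k]) auto
  have "?T * A * ?T = four_block_mat (a * A11 * a) (a * A12 * b) (b * ?A21 * a) (b * A22 * b)"
    unfolding assms(8) by (rule mult_four_block_mat_diag) (use a b A11 A12 A21 A22 in auto)
  also have "a * A11 * a = 1\<^sub>m n"
    unfolding s(2) using a s(1) by (simp add: mult_mat_assoc sa)
  also have "b * A22 * b = 1\<^sub>m k"
    unfolding t(2) using b t(1) by (simp add: mult_mat_assoc tb)
  also note R_def[symmetric]
  also note R'_def[symmetric]
  finally have K: "mat_adjoint ?T * A * ?T = ?K" using hT by simp
  \<comment> \<open>The block diagonal matrix of \<open>s\<close> and \<open>t\<close> is the left
    inverse that the congruence lemma asks for.\<close>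
  have "four_block_mat s (0\<^sub>m n k) (0\<^sub>m k n) t * ?T = 1\<^sub>m (n + k)"
    using a b s(1) t(1) sa tb by (subst mult_four_block_mat[of _ n n _ k _ k _ _ n _ k]) auto
  then have "pos_def_mat ?K"
    unfolding K[symmetric] by (intro pos_def_congruence[OF A assms(4)]) (use a b s t in auto)
  note pdR = pos_def_unit_blocks_contraction[OF R this]

  \<comment> \<open>Since \<open>F\<close> is the adjoint of \<open>R\<close>, \<open>G\<close> is
    \<open>1\<^sub>m n - mat_adjoint F * F\<close> and \<open>H\<close> is
    \<open>1\<^sub>m k - F * mat_adjoint F\<close>.\<close>
  define G where "G = 1\<^sub>m n - R * mat_adjoint R"
  define H where "H = 1\<^sub>m k - mat_adjoint R * R"
  have G: "G \<in> carrier_mat n n" and H: "H \<in> carrier_mat k k" unfolding G_def H_def using R by auto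
  define q where "q = mat_inv_sqrt G"
  define p where "p = mat_inv_sqrt H"
  obtain g where g: "g \<in> carrier_mat n n" "G = g * g" "g * q = 1\<^sub>m n" "q * g = 1\<^sub>m n"
    and Q: "q \<in> carrier_mat n n" "mat_adjoint q = q"
    using mat_inv_sqrt[OF G pdR(1)[folded G_def], folded q_def] by metis
  obtain h where h: "h \<in> carrier_mat k k" "H = h * h" "h * p = 1\<^sub>m k" "p * h = 1\<^sub>m k"
    and P: "p \<in> carrier_mat k k" "mat_adjoint p = p"
    using mat_inv_sqrt[OF H pdR(2)[folded H_def], folded p_def] by metis

  have M: "M = four_block_mat (p) (F * q) (mat_adjoint F * p) (q)"
    unfolding M_def p_def q_def G_def H_def by (simp add: F_def)
  have M_in: "M \<in> indef_unitary_group k n"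
    unfolding M
  proof (rule hyperbolic_block_in_indef_unitary_group[OF F P(1) Q(1) P(2) Q(2)])
    have "p * H * p = 1\<^sub>m k"
      unfolding h(2) using P h(1,3,4) by (simp add: mult_mat_assoc)
    then show "p * (1\<^sub>m k - F * mat_adjoint F) * p = 1\<^sub>m k"
      by (simp add: F_def H_def)
    have "q * G * q = 1\<^sub>m n"
      unfolding g(2) using Q g(1,3,4) by (simp add: mult_mat_assoc)
    then show "q * (1\<^sub>m n - mat_adjoint F * F) * q = 1\<^sub>m n"
      by (simp add: F_def G_def)
  qed
  have Z: "Z = q" unfolding assms(12) M using P Q by simp
  have Zc: "Z \<in> carrier_mat n n" unfolding Z by (rule Q(1))
  have ZZ: "Z * mat_adjoint Z \<in> carrier_mat n n" unfolding Z using Q by auto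
  \<comment> \<open>\<open>Z\<close> is the Hermitian \<open>q\<close>, the inverse of the root
    \<open>g\<close> of \<open>G\<close>, so its square inverts \<open>G\<close>.\<close>
  have GZ: "G * (Z * mat_adjoint Z) = 1\<^sub>m n"
    unfolding Z Q(2) g(2) using g(1,3) Q(1)
    by (simp add: mult_mat_assoc mult_cancel_inverse[OF g(3)])
  have ZG: "Z * mat_adjoint Z * G = 1\<^sub>m n" by (rule mat_mult_left_right_inverse[OF G ZZ GZ])
  have Ginv: "mat_inv G = Z * mat_adjoint Z" by (rule mat_inv_eqI[OF G ZZ GZ])

  obtain Y where Y: "Y \<in> carrier_mat (n + k) (n + k)" "A * Y = 1\<^sub>m (n + k)"
    using pos_def_invertible[OF A assms(4)] by auto
  have Ainv: "mat_inv A = Y" by (rule mat_inv_eqI[OF A Y])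
  \<comment> \<open>\<open>Y11\<close> is the corner of the inverse of \<open>A\<close> that occurs
    in the similarity.\<close>
  obtain Y11 Y12 Y21 Y22 where split: "split_block Y n n = (Y11, Y12, Y21, Y22)"
    by (cases "split_block Y n n") auto
  from split_block[OF split, of k k] Y(1)
  have Yc: "Y11 \<in> carrier_mat n n" "Y12 \<in> carrier_mat n k" "Y21 \<in> carrier_mat k n" "Y22 \<in> carrier_mat k k"
    and Yb: "Y = four_block_mat Y11 Y12 Y21 Y22" by auto
  have "four_block_mat (A11 * Y11 + A12 * Y21) (A11 * Y12 + A12 * Y22) (?A21 * Y11 + A22 * Y21) (?A21 * Y12 + A22 * Y22)
    = four_block_mat (1\<^sub>m n) (0\<^sub>m n k) (0\<^sub>m k n) (1\<^sub>m k)"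
    using Y(2) unfolding assms(8) Yb mult_four_block_mat[OF A11 A12 A21 A22 Yc] by simp
  \<comment> \<open>Only the first block column of \<open>A * Y\<close> is extracted: two equations
    in \<open>Y11\<close> and \<open>Y21\<close>.\<close>
  then have Y1: "A11 * Y11 + A12 * Y21 = 1\<^sub>m n" and Y2: "?A21 * Y11 + A22 * Y21 = 0\<^sub>m k n"
    using A11 A12 A21 A22 Yc by (subst (asm) four_block_mat_eq_iff[of _ n n _ k _ k]; auto)+
  \<comment> \<open>Inverting the definition of \<open>R\<close> expresses the off-diagonal blocks
    through \<open>R\<close>, \<open>s\<close> and \<open>t\<close>.\<close>
  have A12': "A12 = s * R * t"
    unfolding R_def using a b s t A12 by (simp add: mult_mat_assoc mult_cancel_inverse[OF sa(1)] tb)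
  have A21': "?A21 = t * mat_adjoint R * s"
    unfolding R'_def using a b s t A12 by (simp add: mult_mat_assoc mult_cancel_inverse[OF tb(1)] sa)
  \<comment> \<open>Solve the second block equation for \<open>t * Y21\<close>, the form in which
    \<open>Y21\<close> enters once \<open>A12\<close> is written as
    \<open>s * R * t\<close>.\<close>
  have "t * Y21 = b * (A22 * Y21)"
    unfolding t(2) using b t(1) Yc by (simp add: mult_mat_assoc mult_cancel_inverse[OF tb(2)])
  also have "A22 * Y21 = - (?A21 * Y11)"
  proof (rule eq_matI)
    fix i j assume "i < dim_row (- (?A21 * Y11))" "j < dim_col (- (?A21 * Y11))"
    then show "(A22 * Y21) $$ (i, j) = (- (?A21 * Y11)) $$ (i, j)"
      using arg_cong[OF Y2, of "\<lambda>M. M $$ (i, j)"] A22 A12 Yc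
      by (simp add: eq_neg_iff_add_eq_0 add.commute del: index_mult_mat(1))
  qed (use A22 A12 Yc in auto)
  also have "b * - (?A21 * Y11) = - (mat_adjoint R * (s * Y11))"
    unfolding A21' using b(1) t(1) s(1) R Yc(1)
    by (simp add: mult_mat_assoc mult_cancel_inverse[OF tb(2)])
  finally have tY: "t * Y21 = - (mat_adjoint R * (s * Y11))" .
  \<comment> \<open>Substituting into the first equation eliminates \<open>Y21\<close> and leaves
    the Schur complement \<open>G\<close> of the scaled matrix.\<close>
  have "s * (G * (s * Y11)) = A11 * Y11 + A12 * Y21"
  proof -
    have "A12 * Y21 = - (s * (R * (mat_adjoint R * (s * Y11))))"
      unfolding A12' using s(1) t(1) R Yc tY by (simp add: mult_mat_assoc)
    moreover have "s * (G * (s * Y11)) = A11 * Y11 - s * (R * (mat_adjoint R * (s * Y11)))"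
      unfolding G_def s(2) using s(1) R Yc
      by (simp add: minus_mult_distrib_mat[of _ n n _ _ n] mult_mat_assoc)
        (subst mult_minus_distrib_mat[of _ n n _ n], auto intro!: carrier_matI)
    ultimately show ?thesis
      using minus_add_uminus_mat[of "A11 * Y11" n n "s * (R * (mat_adjoint R * (s * Y11)))"] A11 s(1) R Yc
      by (metis (no_types) carrier_matD carrier_matI index_mult_mat(2,3))
  qed
  then have sGsY: "s * (G * (s * Y11)) = 1\<^sub>m n" using Y1 by simp
  \<comment> \<open>Peels off \<open>s\<close> with \<open>a\<close> and \<open>G\<close> with its
    inverse, isolating \<open>s * Y11\<close>.\<close>
  have "s * Y11 = Z * mat_adjoint Z * (a * (s * (G * (s * Y11))))"
    using Zc a(1) s(1) G Yc
    by (simp add: mult_cancel_inverse[OF sa(2)] mult_cancel_inverse[OF ZG])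
  then have sY: "s * Y11 = Z * mat_adjoint Z * a" using sGsY ZZ a by simp
  \<comment> \<open>With \<open>A11 = s * s\<close>, this is a conjugation by \<open>s\<close>,
    whose inverse is \<open>a\<close>.\<close>
  have "A11 * Y11 = s * (Z * mat_adjoint Z) * a"
    unfolding s(2) using sY s(1) Zc a(1) Yc by (simp add: mult_mat_assoc)
  moreover have "corner n A * corner n (mat_inv A) = A11 * Y11"
    unfolding Ainv unfolding Yb assms(8) using A11 Yc by simp
  ultimately have "similar_mat_wit (corner n A * corner n (mat_inv A)) (Z * mat_adjoint Z) s a"
    by (intro similar_mat_witI[OF sa]) (use A11 Yc ZZ s a in auto)
  then have sim: "similar_mat (corner n A * corner n (mat_inv A)) (Z * mat_adjoint Z)"
    unfolding similar_mat_def by blast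
  \<comment> \<open>The difference to the identity is
    \<open>1\<^sub>m n - R * mat_adjoint R\<close>, positive definite by the first fact in
    \<open>pdR\<close>.\<close>
  have "loewner_less (mat_adjoint F * F) (1\<^sub>m n)"
    unfolding loewner_less_def F' using pdR(1) R
    by (auto simp: F_def mat_adjoint_mult intro!: hermitian_matI)
  then show ?thesis using F M_in Ginv sim unfolding k_def[symmetric] G_def by simp
qed

end
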